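(* Let $p,q$ be positive integers, let $M\in\mathbb{S}^{p,q}$ and $N\in\mathbf{\Pi}_{1,qp}$. Assume that $N_{22}=Q_{22}\otimes I_p$ for some $Q_{22}\in\mathbb{S}^q$. Define $Q\in\mathbb{S}^{p,q}$ by $$Q:=\begin{bmatrix}(N|N_{22})I_p+Q_{12}Q_{22}^{\dagger}Q_{21} & Q_{12}\\ Q_{21} & Q_{22}\end{bmatrix},$$ where $Q_{12}\in\mathbb{R}^{p\times q}$ is determined by $\operatorname{vec}(Q_{12})=N_{21}$ and $Q_{21}=Q_{12}^{\top}$. Then the implication $$Z\in\mathbb{R}^{q\times p}\text{ and }\operatorname{vec}(Z^{\top})\in\mathcal{Z}_{qp}(N)\ \Rightarrow\ Z\in\mathcal{Z}_q^{+}(M)\qquad(\ast)$$ holds if and only if $$Z\in\mathcal{Z}_q(Q)\ \Rightarrow\ Z\in\mathcal{Z}_q^{+}(M).$$ Moreover, assume that either $M_{22}\le 0$ or $N_{22}<0$. Then the implication $(\ast)$ holds if and only if there exist scalars $\alpha\ge 0$ and $\beta>0$ such that $$M-\alpha Q\ \ge\ \begin{bmatrix}\beta I_p & 0\\ 0&0\end{bmatrix}.$$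
   Context: All matrices are real. $\mathbb{S}^n$ is the set of symmetric $n\times n$ matrices; for symmetric matrices, $\ge,>,\le,<$ refer to positive/negative (semi)definiteness. $\mathbb{S}^{p,q}$ is the set of symmetric $(p+q)\times(p+q)$ matrices $\Pi$ partitioned as $\Pi=\begin{bmatrix}\Pi_{11}&\Pi_{12}\\ \Pi_{21}&\Pi_{22}\end{bmatrix}$ with $\Pi_{11}\in\mathbb{S}^p$, $\Pi_{22}\in\mathbb{S}^q$. $Y^{\dagger}$ is the Moore-Penrose pseudoinverse, $\otimes$ the Kronecker product, and $\operatorname{vec}(Y)$ stacks the columns of $Y$ into one column vector. The generalized Schur complement is $\Pi|\Pi_{22}:=\Pi_{11}-\Pi_{12}\Pi_{22}^{\dagger}\Pi_{21}$. Define $$\mathbf{\Pi}_{p,q}:=\{\Pi\in\mathbb{S}^{p,q}\mid \Pi_{22}\le 0,\ \ker\Pi_{22}\subseteq\ker\Pi_{12},\ \Pi|\Pi_{22}\ge 0\}.$$ For $\Pi\in\mathbb{S}^{p,q}$, $$\mathcal{Z}_q(\Pi):=\Big\{Z\in\mathbb{R}^{q\times p}\ \Big|\ \begin{bmatrix}I\\Z\end{bmatrix}^{\top}\Pi\begin{bmatrix}I\\Z\end{bmatrix}\ge 0\Big\},\qquad \mathcal{Z}_q^{+}(\Pi):=\Big\{Z\in\mathbb{R}^{q\times p}\ \Big|\ \begin{bmatrix}I\\Z\end{bmatrix}^{\top}\Pi\begin{bmatrix}I\\Z\end{bmatrix}> 0\Big\}.$$ (For $N\in\mathbb{S}^{1,qp}$,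 $\mathcal{Z}_{qp}(N)$ is thus a set of vectors in $\mathbb{R}^{qp}$, and $N|N_{22}$ is a scalar.) *)

theory Defs
  imports "HOL-Analysis.Analysis"
begin

text \<open>
  An \<open>m \<times> n\<close> real matrix has type \<open>real ^ 'n ^ 'm\<close> (columns first, rows last).  The library
  orders this type componentwise, so the semidefinite order is introduced separately.
\<close>

definition symmetric_mats :: "(real ^ 'n ^ 'n) set" where
  "symmetric_mats = {A. transpose A = A}"

definition loewner_le :: "real ^ 'n ^ 'n \<Rightarrow> real ^ 'n ^ 'n \<Rightarrow> bool" where
  "loewner_le A B \<longleftrightarrow> B - A \<in> symmetric_mats \<and> (\<forall>x. 0 \<le> x \<bullet> ((B - A) *v x))"

definition loewner_less :: "real ^ 'n ^ 'n \<Rightarrow> real ^ 'n ^ 'n \<Rightarrow> bool" where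
  "loewner_less A B \<longleftrightarrow> B - A \<in> symmetric_mats \<and> (\<forall>x. x \<noteq> 0 \<longrightarrow> 0 < x \<bullet> ((B - A) *v x))"

definition mat_ker :: "real ^ 'n ^ 'm \<Rightarrow> (real ^ 'n) set" where
  "mat_ker A = {x. A *v x = 0}"

definition is_pinv :: "real ^ 'n ^ 'm \<Rightarrow> real ^ 'm ^ 'n \<Rightarrow> bool" where
  "is_pinv A X \<longleftrightarrow>
     A ** X ** A = A \<and> X ** A ** X = X \<and>
     transpose (A ** X) = A ** X \<and> transpose (X ** A) = X ** A"

definition pinv :: "real ^ 'n ^ 'm \<Rightarrow> real ^ 'm ^ 'n" where
  "pinv A = (THE X. is_pinv A X)"

lemma is_pinv_unique:
  assumes "is_pinv A X" "is_pinv A Y"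
  shows "X = Y"
proof -
  have AX: "A ** X = A ** Y"
  proof -
    have "A ** X = (A ** Y) ** (A ** X)"
      using assms(2) by (simp add: is_pinv_def matrix_mul_assoc)
    also have "\<dots> = transpose ((A ** X) ** (A ** Y))"
      using assms by (simp add: is_pinv_def matrix_transpose_mul)
    also have "(A ** X) ** (A ** Y) = A ** Y"
      using assms(1) by (simp add: is_pinv_def matrix_mul_assoc)
    finally show ?thesis
      using assms(2) by (simp add: is_pinv_def)
  qed
  have XA: "X ** A = Y ** A"
  proof -
    have "X ** A = (X ** A) ** (Y ** A)"
      using assms(2) by (metis is_pinv_def matrix_mul_assoc)
    also have "\<dots> = transpose ((Y ** A) ** (X ** A))"
      using assms by (simp add: is_pinv_def matrix_transpose_mul)
    also have "(Y ** A) ** (X ** A) = Y ** A"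
      using assms(1) by (metis is_pinv_def matrix_mul_assoc)
    finally show ?thesis
      using assms(2) by (simp add: is_pinv_def)
  qed
  have "X = X ** A ** X"
    using assms(1) by (simp add: is_pinv_def)
  also have "\<dots> = Y ** (A ** Y)"
    by (simp add: XA AX flip: matrix_mul_assoc)
  also have "\<dots> = Y"
    using assms(2) by (simp add: is_pinv_def matrix_mul_assoc)
  finally show ?thesis .
qed

lemma least_squares_exists:
  fixes A :: "real ^ 'n ^ 'm"
  shows "\<exists>x. transpose A *v (A *v x) = transpose A *v y"
proof -
  obtain u v where u: "u \<in> span (range ((*v) A))"
    and v: "\<And>w. w \<in> span (range ((*v) A)) \<Longrightarrow> orthogonal v w" and y: "y = u + v"
    using orthogonal_subspace_decomp_exists by blast
  have "span (range ((*v) A)) = range ((*v) A)"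
    by (simp add: span_eq_iff linear_subspace_image matrix_vector_mul_linear)
  with u obtain x where x: "u = A *v x" by auto
  have "w \<bullet> (transpose A *v v) = 0" for w
  proof -
    have "A *v w \<in> span (range ((*v) A))" by (simp add: span_base)
    then have "v \<bullet> (A *v w) = 0" using v by (simp add: orthogonal_def)
    then show ?thesis
      by (simp add: dot_lmul_matrix[symmetric] inner_commute)
  qed
  then have "transpose A *v v = 0"
    by (metis inner_eq_zero_iff)
  then have "transpose A *v (A *v x) = transpose A *v y"
    by (simp add: y x matrix_vector_right_distrib)
  then show ?thesis by blast
qed

lemma least_squares_inverse_exists:
  fixes A :: "real ^ 'n ^ 'm"
  shows "\<exists>B. transpose (A ** B) = A ** B \<and> A ** B ** A = A"
proof -
  obtain f where f: "\<And>y. transpose A *v (A *v f y) = transpose A *v y"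
    using least_squares_exists[of A] by metis
  define B :: "real ^ 'm ^ 'n" where "B = (\<chi> i j. f (axis j 1) $ i)"
  have colB: "B *v axis j 1 = f (axis j 1)" for j
    by (simp add: B_def matrix_vector_mul_component vec_eq_iff inner_axis)
  have col: "transpose A ** (A ** B) *v axis j 1 = transpose A *v axis j 1" for j
    by (simp only: colB f matrix_vector_mul_assoc[symmetric])
  have normal: "transpose A ** (A ** B) = transpose A"
    using col by (simp only: matrix_vector_mult_basis) (simp add: column_def vec_eq_iff)
  have "transpose (A ** B) ** (A ** B) = transpose (A ** B)"
    by (metis matrix_mul_assoc matrix_transpose_mul normal)
  then have sym: "transpose (A ** B) = A ** B"
    by (metis matrix_transpose_mul transpose_transpose)
  have "A ** B ** A = transpose (transpose A ** transpose (A ** B))"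
    by (simp add: matrix_transpose_mul)
  also have "\<dots> = A"
    by (simp add: sym normal)
  finally show ?thesis using sym by blast
qed

lemma is_pinv_exists:
  fixes A :: "real ^ 'n ^ 'm"
  shows "\<exists>X. is_pinv A X"
proof -
  obtain B where B: "transpose (A ** B) = A ** B" "A ** B ** A = A"
    using least_squares_inverse_exists by blast
  obtain D where D: "transpose (transpose A ** D) = transpose A ** D"
      "transpose A ** D ** transpose A = transpose A"
    using least_squares_inverse_exists by blast
  define C where "C = transpose D"
  have C1: "transpose (C ** A) = C ** A"
    using D(1) by (simp add: C_def matrix_transpose_mul)
  have C2: "A ** C ** A = A"
    using arg_cong[OF D(2), of transpose]
    by (simp add: C_def matrix_transpose_mul matrix_mul_assoc)
  have "A ** (C ** A ** B) = A ** B"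
    by (metis C2 matrix_mul_assoc)
  moreover have "C ** A ** B ** A = C ** A"
    by (metis B(2) matrix_mul_assoc)
  moreover have "C ** A ** (C ** A ** B) = C ** A ** B"
    by (metis C2 matrix_mul_assoc)
  ultimately have "is_pinv A (C ** A ** B)"
    using B C1 by (simp add: is_pinv_def)
  then show ?thesis by blast
qed

lemma is_pinv_pinv: "is_pinv A (pinv A)"
  unfolding pinv_def by (rule theI') (use is_pinv_exists is_pinv_unique in blast)

definition kron :: "real ^ 'b ^ 'a \<Rightarrow> real ^ 'd ^ 'c \<Rightarrow> real ^ ('b::finite \<times> 'd::finite) ^ ('a::finite \<times> 'c::finite)" where
  "kron A B = (\<chi> r s. A $ fst r $ fst s * B $ snd r $ snd s)"

text \<open>
  Column stacking, as a one-column matrix.  The entry of \<open>vec(Y)\<close> coming from column \<open>j\<close> and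
  row \<open>i\<close> of \<open>Y\<close> has index \<open>(j, i)\<close>; the usual linear enumeration is the lexicographic order
  on these pairs, the same as the one for the rows and columns of \<open>kron\<close>.
  (The library constant \<open>vec\<close> is unrelated: it builds constant vectors.)
\<close>

definition vectorize :: "real ^ 'c ^ 'r \<Rightarrow> real ^ 1 ^ ('c::finite \<times> 'r::finite)" where
  "vectorize Y = (\<chi> k l. Y $ snd k $ fst k)"

text \<open>The partition of a \<open>(p+q) \<times> (p+q)\<close> matrix is given by the sum type indexing it.\<close>

definition blk11 :: "real ^ ('p::finite + 'q::finite) ^ ('p + 'q) \<Rightarrow> real ^ 'p ^ 'p" where
  "blk11 A = (\<chi> i j. A $ Inl i $ Inl j)"

definition blk12 :: "real ^ ('p::finite + 'q::finite) ^ ('p + 'q) \<Rightarrow> real ^ 'q ^ 'p" where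
  "blk12 A = (\<chi> i j. A $ Inl i $ Inr j)"

definition blk21 :: "real ^ ('p::finite + 'q::finite) ^ ('p + 'q) \<Rightarrow> real ^ 'p ^ 'q" where
  "blk21 A = (\<chi> i j. A $ Inr i $ Inl j)"

definition blk22 :: "real ^ ('p::finite + 'q::finite) ^ ('p + 'q) \<Rightarrow> real ^ 'q ^ 'q" where
  "blk22 A = (\<chi> i j. A $ Inr i $ Inr j)"

definition block_mat ::
  "real ^ 'p ^ 'p \<Rightarrow> real ^ 'q ^ 'p \<Rightarrow> real ^ 'p ^ 'q \<Rightarrow> real ^ 'q ^ 'q \<Rightarrow> real ^ ('p::finite + 'q::finite) ^ ('p + 'q)"
where
  "block_mat A B C D =
     (\<chi> r s. case r of
        Inl i \<Rightarrow> (case s of Inl j \<Rightarrow> A $ i $ j | Inr j \<Rightarrow> B $ i $ j)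
      | Inr i \<Rightarrow> (case s of Inl j \<Rightarrow> C $ i $ j | Inr j \<Rightarrow> D $ i $ j))"

definition gen_schur :: "real ^ ('p::finite + 'q::finite) ^ ('p + 'q) \<Rightarrow> real ^ 'p ^ 'p" where
  "gen_schur P = blk11 P - blk12 P ** pinv (blk22 P) ** blk21 P"

definition Pi_class :: "(real ^ ('p::finite + 'q::finite) ^ ('p + 'q)) set" where
  "Pi_class = {P \<in> symmetric_mats.
     loewner_le (blk22 P) 0 \<and> mat_ker (blk22 P) \<subseteq> mat_ker (blk12 P) \<and> loewner_le 0 (gen_schur P)}"

text \<open>The block column with the identity on top of \<open>Z\<close>.\<close>

definition id_above :: "real ^ 'p ^ 'q \<Rightarrow> real ^ 'p ^ ('p::finite + 'q::finite)" where
  "id_above Z = (\<chi> r j. case r of Inl i \<Rightarrow> mat 1 $ i $ j | Inr i \<Rightarrow> Z $ i $ j)"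

definition Zset :: "real ^ ('p::finite + 'q::finite) ^ ('p + 'q) \<Rightarrow> (real ^ 'p ^ 'q) set" where
  "Zset P = {Z. loewner_le 0 (transpose (id_above Z) ** P ** id_above Z)}"

definition Zset_pos :: "real ^ ('p::finite + 'q::finite) ^ ('p + 'q) \<Rightarrow> (real ^ 'p ^ 'q) set" where
  "Zset_pos P = {Z. loewner_less 0 (transpose (id_above Z) ** P ** id_above Z)}"

end

theory Submission
  imports Defs
begin

text \<open>
  Let \<open>s = N|N\<^sub>2\<^sub>2\<close> and choose \<open>Z\<^sub>0\<close> with \<open>Q\<^sub>2\<^sub>2 Z\<^sub>0 = - Q\<^sub>2\<^sub>1\<close>.  Completing squares, the form of \<open>Q\<close> at
  \<open>(x, y)\<close> is \<open>s |x|\<^sup>2\<close> plus the form of \<open>Q\<^sub>2\<^sub>2\<close> at \<open>y - Z\<^sub>0 x\<close>, so that membership in the set of \<open>Q\<close> is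
  a spectral norm bound on \<open>Z - Z\<^sub>0\<close>, weighted by \<open>- Q\<^sub>2\<^sub>2\<close>, and membership in the set of \<open>N\<close> is the
  corresponding Frobenius norm bound.  The two norms agree on rank one matrices, and positivity of
  the form of \<open>M\<close> at a given \<open>(x, y)\<close> with \<open>x \<noteq> 0\<close> can be tested with a \<open>Z\<close> that differs from \<open>Z\<^sub>0\<close> by
  rank one and satisfies \<open>Z x = y\<close>.  Hence both implications say that the form of \<open>M\<close> is
  positive wherever \<open>x \<noteq> 0\<close> and the form of \<open>Q\<close> is nonnegative.  The multipliers then come
  from the homogeneous strict S-lemma, applied on a complement of \<open>ker Q\<^sub>2\<^sub>2\<close>, because both forms are
  invariant under translation of \<open>y\<close> by that kernel.
\<close>

section \<open>Quadratic forms\<close>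

definition qform :: "real ^ 'n ^ 'n \<Rightarrow> real ^ 'n \<Rightarrow> real" where
  "qform A v = v \<bullet> (A *v v)"

lemma symmetric_mats_inner:
  assumes "A \<in> symmetric_mats"
  shows "x \<bullet> (A *v y) = (A *v x) \<bullet> y"
  using assms by (metis (mono_tags, lifting) dot_lmul_matrix mem_Collect_eq symmetric_mats_def transpose_matrix_vector)

lemma qform_add:
  assumes "A \<in> symmetric_mats"
  shows "qform A (u + v) = qform A u + 2 * (u \<bullet> (A *v v)) + qform A v"
proof -
  have "v \<bullet> (A *v u) = u \<bullet> (A *v v)"
    using symmetric_mats_inner[OF assms, of v u] by (simp add: inner_commute)
  then show ?thesis
    by (simp add: qform_def matrix_vector_right_distrib inner_add_left inner_add_right)
qed

lemma qform_scaleR: "qform A (c *\<^sub>R v) = c\<^sup>2 * qform A v"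
  by (simp add: qform_def matrix_vector_mult_scaleR power2_eq_square)

lemma qform_zero [simp]: "qform A 0 = 0"
  by (simp add: qform_def)

lemma qform_diff_scaleR: "qform (A - c *\<^sub>R B) v = qform A v - c * qform B v"
  by (simp add: qform_def matrix_vector_mult_diff_rdistrib scaleR_matrix_vector_assoc[symmetric] inner_diff_right)

lemma continuous_on_qform: "continuous_on S (qform A)"
  unfolding qform_def by (intro continuous_intros matrix_vector_mult_linear_continuous_on)

text \<open>A nonnegative form is minimal at \<open>k\<close>, so its gradient there vanishes;
  otherwise a step from \<open>k\<close> against \<open>A *v k\<close> would make it
  negative.\<close>

lemma psd_qform_zero_imp_ker:
  assumes "A \<in> symmetric_mats" "\<And>x. 0 \<le> qform A x" "qform A k = 0"
  shows "A *v k = 0"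
proof -
  define b where "b = A *v k"
  define c where "c = qform A b"
  have c: "0 \<le> c" using assms(2) by (simp add: c_def)
  have e: "qform A (k + t *\<^sub>R b) = 2 * t * (b \<bullet> b) + t\<^sup>2 * c" for t
    using symmetric_mats_inner[OF assms(1), of k b] assms(3)
    by (simp add: qform_add[OF assms(1)] qform_scaleR matrix_vector_mult_scaleR b_def c_def)
  show ?thesis
  proof (rule ccontr)
    assume "A *v k \<noteq> 0"
    then have b: "0 < b \<bullet> b" by (simp add: b_def)
    \<comment> \<open>With this step length the value at \<open>- t\<close> collapses to
      \<open>- (t\<^sup>2 * (2 + c))\<close>.\<close>
    define t where "t = (b \<bullet> b) / (1 + c)"
    have t: "0 < t" "t * (1 + c) = b \<bullet> b" using b c by (auto simp: t_def)
    have "0 \<le> 2 * (- t) * (b \<bullet> b) + (- t)\<^sup>2 * c"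
      using e assms(2) by metis
    also have "\<dots> = - (t\<^sup>2 * (2 + c))"
      unfolding t(2)[symmetric] by (simp add: power2_eq_square algebra_simps)
    also have "\<dots> < 0" using t c by (simp add: zero_less_mult_iff)
    finally show False by simp
  qed
qed

lemma loewner_le_qform: "loewner_le A B \<longleftrightarrow> B - A \<in> symmetric_mats \<and> (\<forall>x. qform A x \<le> qform B x)"
  by (simp add: loewner_le_def qform_def matrix_vector_mult_diff_rdistrib inner_diff_right)

lemma loewner_less_qform:
  "loewner_less A B \<longleftrightarrow> B - A \<in> symmetric_mats \<and> (\<forall>x. x \<noteq> 0 \<longrightarrow> qform A x < qform B x)"
  by (simp add: loewner_less_def qform_def matrix_vector_mult_diff_rdistrib inner_diff_right)

lemma qform_zero_mat [simp]: "qform 0 v = 0"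
  by (simp add: qform_def)

lemma zero_symmetric_mats: "0 \<in> symmetric_mats"
  by (simp add: symmetric_mats_def transpose_def vec_eq_iff)

lemma symmetric_mats_diff:
  assumes "A \<in> symmetric_mats" "B \<in> symmetric_mats"
  shows "A - B \<in> symmetric_mats"
  using assms by (simp add: symmetric_mats_def transpose_def vec_eq_iff)

lemma symmetric_mats_scaleR:
  assumes "A \<in> symmetric_mats"
  shows "c *\<^sub>R A \<in> symmetric_mats"
  using assms by (simp add: symmetric_mats_def transpose_def vec_eq_iff)

section \<open>The homogeneous strict S-lemma on a subspace\<close>

text \<open>Evaluating the first form at the two null vectors of the second one in the plane spanned
  by \<open>u\<close> and \<open>v\<close>, with weights that cancel the mixed term, gives the inequality.\<close>

lemma qform_ratio_less:
  assumes A: "A \<in> symmetric_mats" and B: "B \<in> symmetric_mats" and V: "subspace V"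
    and pos: "\<And>v. v \<in> V \<Longrightarrow> v \<noteq> 0 \<Longrightarrow> 0 \<le> qform B v \<Longrightarrow> 0 < qform A v"
    and u: "u \<in> V" "qform B u < 0" and v: "v \<in> V" "0 < qform B v"
  shows "qform A u * qform B v > qform A v * qform B u"
proof -
  define b where "b = u \<bullet> (B *v v)"
  define a where "a = u \<bullet> (A *v v)"
  define g where "g = qform B u"
  define h where "h = qform B v"
  have gh: "g < 0" "h > 0" using u v by (simp_all add: g_def h_def)
  \<comment> \<open>With the coefficient of \<open>v\<close> fixed at \<open>g\<close>, the form of
    \<open>B\<close> is \<open>g * ((t + b)\<^sup>2 - D\<^sup>2)\<close>, so its null vectors sit at
    \<open>t = - b - D\<close> and \<open>t = D - b\<close>. Since \<open>g * h < 0\<close>, these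
    roots have opposite signs.\<close>
  define D where "D = sqrt (b\<^sup>2 - g * h)"
  have gh0: "g * h < 0" using gh by (simp add: mult_neg_pos)
  have D2: "D\<^sup>2 = b\<^sup>2 - g * h" using order_trans[OF less_imp_le[OF gh0] zero_le_power2[of b]] by (simp add: D_def)
  have "sqrt (b\<^sup>2) < D" unfolding D_def by (rule real_sqrt_less_mono) (use gh0 in simp)
  then have Db: "\<bar>b\<bar> < D" by simp
  have eB: "qform B (t *\<^sub>R u + g *\<^sub>R v) = t\<^sup>2 * g + 2 * t * g * b + g\<^sup>2 * h" for t
    by (simp add: qform_add[OF B] qform_scaleR matrix_vector_mult_scaleR b_def g_def h_def)
  have eA: "qform A (t *\<^sub>R u + g *\<^sub>R v) = t\<^sup>2 * qform A u + 2 * t * g * a + g\<^sup>2 * qform A v" for t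
    by (simp add: qform_add[OF A] qform_scaleR matrix_vector_mult_scaleR a_def)
  have root: "0 < t\<^sup>2 * qform A u + 2 * t * g * a + g\<^sup>2 * qform A v" if "(t + b)\<^sup>2 = D\<^sup>2" for t
  proof -
    have "t\<^sup>2 * g + 2 * t * g * b + g\<^sup>2 * h = g * ((t + b)\<^sup>2 - D\<^sup>2)"
      unfolding D2 by (simp add: power2_eq_square algebra_simps)
    then have z: "qform B (t *\<^sub>R u + g *\<^sub>R v) = 0" using that by (simp add: eB)
    have "t *\<^sub>R u + g *\<^sub>R v \<noteq> 0"
    proof
      assume "t *\<^sub>R u + g *\<^sub>R v = 0"
      then have "g *\<^sub>R v = (- t) *\<^sub>R u" by (simp add: add_eq_0_iff)
      then have "qform B (g *\<^sub>R v) = qform B ((- t) *\<^sub>R u)" by simp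
      then have "g\<^sup>2 * h = t\<^sup>2 * g" by (simp only: qform_scaleR) (simp add: g_def h_def)
      moreover have "g\<^sup>2 * h > 0" using gh by simp
      moreover have "t\<^sup>2 * g \<le> 0" using gh by (simp add: mult_nonneg_nonpos)
      ultimately show False by simp
    qed
    moreover have "t *\<^sub>R u + g *\<^sub>R v \<in> V"
      using V u v by (simp add: subspace_add subspace_scale)
    ultimately show ?thesis using pos z eA by (metis order_refl)
  qed
  define t1 where "t1 = - b - D"
  define t2 where "t2 = D - b"
  have t: "t1 < 0" "0 < t2" using Db by (auto simp: t1_def t2_def)
  have t12: "- (t1 * t2) = - (g * h)"
    using D2 by (simp add: t1_def t2_def power2_eq_square algebra_simps)
  \<comment> \<open>The positive weights \<open>t2\<close> and \<open>- t1\<close> cancel the terms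
    in \<open>a\<close>; what remains has the common factor \<open>t2 - t1\<close>, and
    \<open>t1 * t2 = g * h\<close> eliminates the roots.\<close>
  have 1: "0 < t2 * (t1\<^sup>2 * qform A u + 2 * t1 * g * a + g\<^sup>2 * qform A v)"
    by (rule mult_pos_pos[OF t(2) root]) (simp add: t1_def power2_eq_square)
  have 2: "0 < (- t1) * (t2\<^sup>2 * qform A u + 2 * t2 * g * a + g\<^sup>2 * qform A v)"
    by (rule mult_pos_pos[OF _ root]) (use t in \<open>simp_all add: t2_def\<close>)
  have "0 < (t2 - t1) * (- (t1 * t2) * qform A u + g\<^sup>2 * qform A v)"
    using add_pos_pos[OF 1 2] by (simp add: power2_eq_square algebra_simps)
  then have "0 < - (g * h) * qform A u + g\<^sup>2 * qform A v"
    using t unfolding t12 by (simp add: zero_less_mult_iff)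
  also have "\<dots> = (- g) * (h * qform A u - g * qform A v)"
    by (simp add: power2_eq_square algebra_simps)
  finally have "0 < h * qform A u - g * qform A v"
    using gh by (simp add: mult_less_0_iff)
  then show ?thesis by (simp add: g_def h_def mult.commute)
qed

lemma compact_sublevel:
  fixes f :: "'a::t2_space \<Rightarrow> real"
  assumes "compact S" "continuous_on S f"
  shows "compact {x \<in> S. f x \<le> c}"
proof -
  have "closed (f -` {..c} \<inter> S)"
    using assms by (simp add: continuous_on_closed_vimage compact_imp_closed)
  then have "compact (S \<inter> (f -` {..c} \<inter> S))"
    using assms(1) by (rule compact_Int_closed[rotated])
  also have "S \<inter> (f -` {..c} \<inter> S) = {x \<in> S. f x \<le> c}" by auto
  finally show ?thesis .
qed

text \<open>By homogeneity the unit sphere of \<open>V\<close> suffices. There \<alpha> must exceed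
  the ratio of the two forms where \<open>A\<close> is nonpositive and stay below it where
  \<open>B\<close> is positive. \<open>qform_ratio_less\<close> separates the two ranges, and
  compactness leaves room for a strict choice and a margin \<beta>.\<close>

lemma strict_S_lemma_subspace:
  assumes A: "A \<in> symmetric_mats" and B: "B \<in> symmetric_mats" and V: "subspace V"
    and pos: "\<And>v. v \<in> V \<Longrightarrow> v \<noteq> 0 \<Longrightarrow> 0 \<le> qform B v \<Longrightarrow> 0 < qform A v"
  obtains \<alpha> \<beta> where "0 \<le> \<alpha>" "0 < \<beta>"
    "\<And>v. v \<in> V \<Longrightarrow> \<beta> * (v \<bullet> v) \<le> qform A v - \<alpha> * qform B v"
proof -
  define S where "S = sphere 0 1 \<inter> V"
  have S: "compact S" unfolding S_def
    using V by (intro compact_Int_closed closed_subspace) auto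
  have Sn: "v \<in> V" "v \<noteq> 0" if "v \<in> S" for v using that by (auto simp: S_def)
  have cont: "continuous_on X (\<lambda>v. qform A v - c * qform B v)" for X c
    by (intro continuous_intros continuous_on_qform)
  have "\<exists>\<alpha>\<ge>0. \<forall>v\<in>S. 0 < qform A v - \<alpha> * qform B v"
  proof (cases "\<forall>v\<in>S. 0 < qform A v")
    case True
    then show ?thesis by (intro exI[of _ 0]) auto
  next
    case False
    define T where "T = {v \<in> S. qform A v \<le> 0}"
    have T: "compact T" "T \<noteq> {}"
      unfolding T_def using False
      by (auto simp: not_less intro!: compact_sublevel S continuous_on_qform)
    have TB: "qform B v < 0" if "v \<in> T" for v
      using that pos[of v] Sn[of v] by (force simp: T_def)
    have "continuous_on T (\<lambda>v. qform A v / qform B v)"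
      by (intro continuous_intros continuous_on_qform) (use TB in force)
    from continuous_attains_sup[OF T this] obtain u where u: "u \<in> T"
      and umax: "\<And>v. v \<in> T \<Longrightarrow> qform A v / qform B v \<le> qform A u / qform B u" by auto
    \<comment> \<open>This lower bound for \<alpha> is attained: the combination with
      \<open>a\<close> vanishes at \<open>u\<close>. It is already positive on the compact set
      \<open>P\<close>, so \<open>a\<close> can be raised slightly.\<close>
    define a where "a = qform A u / qform B u"
    have a0: "0 \<le> a" using u TB[OF u] by (auto simp: a_def T_def divide_nonpos_neg)
    define P where "P = {v \<in> S. 0 \<le> qform B v}"
    have P: "compact P"
      using compact_sublevel[OF S continuous_on_minus[OF continuous_on_qform], of B 0]
      by (simp add: P_def)
    have Ppos: "0 < qform A v - a * qform B v" if "v \<in> P" for v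
    proof (cases "qform B v = 0")
      case True
      then show ?thesis using that pos[of v] Sn[of v] by (auto simp: P_def)
    next
      case False
      then have b: "0 < qform B v" using that by (auto simp: P_def)
      have "qform A u * qform B v > qform A v * qform B u"
        using qform_ratio_less[OF A B V pos] u that b TB[OF u] Sn
        by (auto simp: P_def T_def)
      then show ?thesis using TB[OF u] by (simp add: a_def field_simps)
    qed
    have "\<exists>e>0. \<forall>v\<in>P. 0 < qform A v - (a + e) * qform B v"
    proof (cases "P = {}")
      case True
      then show ?thesis by (intro exI[of _ 1]) auto
    next
      case False
      obtain w where w: "w \<in> P" "\<And>v. v \<in> P \<Longrightarrow> qform A w - a * qform B w \<le> qform A v - a * qform B v"
        using continuous_attains_inf[OF P False cont] by blast
      obtain z where z: "z \<in> P" "\<And>v. v \<in> P \<Longrightarrow> qform B v \<le> qform B z"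
        using continuous_attains_sup[OF P False continuous_on_qform] by blast
      define m where "m = qform A w - a * qform B w"
      \<comment> \<open>The increment uses up at most half of the minimum \<open>m\<close> on
        \<open>P\<close>; adding 1 keeps the denominator positive when the maximum of
        \<open>B\<close> on \<open>P\<close> is 0.\<close>
      define e where "e = m / (2 * (qform B z + 1))"
      have m: "0 < m" using Ppos w by (simp add: m_def)
      have z0: "0 \<le> qform B z" using z by (simp add: P_def)
      have e: "0 < e" using m z0 by (simp add: e_def)
      have "0 < qform A v - (a + e) * qform B v" if "v \<in> P" for v
      proof -
        have "e * qform B v \<le> e * (qform B z + 1)" using z(2)[OF that] e by simp
        also have "\<dots> = m / 2"
          unfolding e_def using z0 by (simp add: divide_simps add_nonneg_eq_0_iff)
        also have "\<dots> < m" using m by simp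
        finally show ?thesis using w(2)[OF that] by (simp add: m_def algebra_simps)
      qed
      with e show ?thesis by blast
    qed
    then obtain e where e: "0 < e" "\<And>v. v \<in> P \<Longrightarrow> 0 < qform A v - (a + e) * qform B v" by blast
    have "0 < qform A v - (a + e) * qform B v" if vS: "v \<in> S" for v
    proof -
      consider "v \<in> P" | "qform B v < 0" "v \<in> T" | "qform B v < 0" "0 < qform A v"
        using vS by (force simp: P_def T_def)
      then show ?thesis
      proof cases
        case 1
        then show ?thesis by (rule e(2))
      next
        case 2
        have "qform A v / qform B v < a + e" using umax[OF 2(2)] e(1) by (simp add: a_def)
        then show ?thesis using 2(1) by (simp add: field_simps)
      next
        case 3
        have "(a + e) * qform B v < 0" using a0 e(1) 3(1) by (simp add: mult_pos_neg)
        then show ?thesis using 3(2) by simp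
      qed
    qed
    then show ?thesis using a0 e(1) by (intro exI[of _ "a + e"]) auto
  qed
  then obtain \<alpha> where \<alpha>: "0 \<le> \<alpha>" "\<And>v. v \<in> S \<Longrightarrow> 0 < qform A v - \<alpha> * qform B v" by blast
  have "\<exists>\<beta>>0. \<forall>v\<in>S. \<beta> \<le> qform A v - \<alpha> * qform B v"
  proof (cases "S = {}")
    case True
    then show ?thesis by (intro exI[of _ 1]) auto
  next
    case False
    then show ?thesis using continuous_attains_inf[OF S False cont[of _ \<alpha>]] \<alpha>(2) by metis
  qed
  then obtain \<beta> where \<beta>: "0 < \<beta>" "\<And>v. v \<in> S \<Longrightarrow> \<beta> \<le> qform A v - \<alpha> * qform B v" by blast
  have "\<beta> * (v \<bullet> v) \<le> qform A v - \<alpha> * qform B v" if "v \<in> V" for v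
  proof (cases "v = 0")
    case False
    define w where "w = (1 / norm v) *\<^sub>R v"
    have "w \<in> S" using False that V by (simp add: S_def w_def subspace_scale)
    have vw: "v = norm v *\<^sub>R w" using False by (simp add: w_def)
    have "(norm v)\<^sup>2 * \<beta> \<le> (norm v)\<^sup>2 * (qform A w - \<alpha> * qform B w)"
      using \<beta>(2)[OF \<open>w \<in> S\<close>] by (simp add: mult_left_mono)
    also have "\<dots> = qform A v - \<alpha> * qform B v"
      using qform_scaleR[of A "norm v" w] qform_scaleR[of B "norm v" w]
      by (simp add: vw[symmetric] algebra_simps)
    finally show ?thesis by (simp add: power2_norm_eq_inner mult.commute)
  qed simp
  with \<alpha>(1) \<beta>(1) show ?thesis by (rule that)
qed

section \<open>Block partitions and vectorization\<close>

definition join :: "real ^ 'p \<Rightarrow> real ^ 'q \<Rightarrow> real ^ ('p::finite + 'q::finite)" where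
  "join x y = (\<chi> r. case r of Inl i \<Rightarrow> x $ i | Inr j \<Rightarrow> y $ j)"

definition upper :: "real ^ ('p::finite + 'q::finite) \<Rightarrow> real ^ 'p" where
  "upper v = (\<chi> i. v $ Inl i)"

definition lower :: "real ^ ('p::finite + 'q::finite) \<Rightarrow> real ^ 'q" where
  "lower v = (\<chi> i. v $ Inr i)"

lemma join_upper_lower: "join (upper v) (lower v) = v"
  by (simp add: join_def upper_def lower_def vec_eq_iff split: sum.split)

lemma upper_join [simp]: "upper (join x y) = x"
  and lower_join [simp]: "lower (join x y) = y"
  by (simp_all add: join_def upper_def lower_def vec_eq_iff)

lemma join_zero: "join 0 0 = 0"
  by (simp add: join_def vec_eq_iff split: sum.split)

lemma sum_UNIV_sum:
  "(\<Sum>r\<in>(UNIV :: ('p::finite + 'q::finite) set). f r) = (\<Sum>i\<in>UNIV. f (Inl i)) + (\<Sum>j\<in>UNIV. f (Inr j))"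
  by (simp add: sum.Plus flip: UNIV_Plus_UNIV)

lemma join_inner: "join x y \<bullet> join x' y' = x \<bullet> x' + y \<bullet> y'"
  by (simp add: inner_vec_def sum_UNIV_sum join_def)

lemma matrix_mult_join:
  "P *v join x y = join (blk11 P *v x + blk12 P *v y) (blk21 P *v x + blk22 P *v y)"
  by (simp add: vec_eq_iff matrix_vector_mult_def sum_UNIV_sum join_def blk11_def blk12_def
      blk21_def blk22_def split: sum.split)

lemma id_above_mult: "id_above Z *v x = join x (Z *v x)"
proof -
  have "(\<Sum>j\<in>UNIV. mat 1 $ i $ j * x $ j) = x $ i" for i
    using matrix_vector_mul_lid[of x] by (simp add: vec_eq_iff matrix_vector_mult_def)
  then show ?thesis
    by (simp add: vec_eq_iff matrix_vector_mult_def join_def id_above_def split: sum.split)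
qed

section \<open>Congruence and the solution sets\<close>

lemma transpose_inner: "x \<bullet> (transpose A *v (y :: real ^ 'm)) = (A *v x) \<bullet> y"
  using dot_lmul_matrix[of y A x] by (simp add: inner_commute)

lemma qform_congruence: "qform (transpose B ** P ** B) x = qform P (B *v x)"
  by (simp only: qform_def transpose_inner flip: matrix_vector_mul_assoc)

lemma symmetric_congruence:
  assumes "P \<in> symmetric_mats"
  shows "transpose B ** P ** B \<in> symmetric_mats"
  using assms by (simp add: symmetric_mats_def matrix_transpose_mul matrix_mul_assoc)

text \<open>Congruence by \<open>id_above Z\<close> restricts the form of \<open>P\<close> to the
  graph of \<open>Z\<close>.\<close>

lemma Zset_iff:
  assumes "P \<in> symmetric_mats"
  shows "Z \<in> Zset P \<longleftrightarrow> (\<forall>x. 0 \<le> qform P (join x (Z *v x)))"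
  using symmetric_congruence[OF assms, of "id_above Z"]
  by (simp add: Zset_def loewner_le_qform qform_congruence id_above_mult)

lemma Zset_pos_iff:
  assumes "P \<in> symmetric_mats"
  shows "Z \<in> Zset_pos P \<longleftrightarrow> (\<forall>x. x \<noteq> 0 \<longrightarrow> 0 < qform P (join x (Z *v x)))"
  using symmetric_congruence[OF assms, of "id_above Z"]
  by (simp add: Zset_pos_def loewner_less_qform qform_congruence id_above_mult)

lemma symmetric_blocks:
  assumes "P \<in> symmetric_mats"
  shows "blk11 P \<in> symmetric_mats" "blk22 P \<in> symmetric_mats" "blk12 P = transpose (blk21 P)"
  using assms by (simp_all add: symmetric_mats_def transpose_def vec_eq_iff blk11_def blk12_def
      blk21_def blk22_def)

lemma blk_block_mat [simp]:
  "blk11 (block_mat A B C D) = A" "blk12 (block_mat A B C D) = B"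
  "blk21 (block_mat A B C D) = C" "blk22 (block_mat A B C D) = D"
  by (simp_all add: block_mat_def blk11_def blk12_def blk21_def blk22_def vec_eq_iff)

lemma symmetric_block_mat:
  assumes "A \<in> symmetric_mats" "D \<in> symmetric_mats" "C = transpose B"
  shows "block_mat A B C D \<in> symmetric_mats"
  using assms by (auto simp: symmetric_mats_def transpose_def vec_eq_iff block_mat_def split: sum.split)

section \<open>Completing the square in the lower block\<close>

lemma transpose_uminus: "transpose (- A) = - transpose (A :: real ^ 'n ^ 'm)"
  by (simp add: transpose_def vec_eq_iff)

lemma matrix_mul_uminus_left: "(- A) ** B = - (A ** (B :: real ^ 'n ^ 'm))"
  by (simp add: matrix_matrix_mult_def vec_eq_iff sum_negf)

lemma matrix_mul_uminus_right: "A ** (- B) = - (A ** (B :: real ^ 'n ^ 'm))"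
  by (simp add: matrix_matrix_mult_def vec_eq_iff sum_negf)

lemma matrix_vector_mul_uminus_left: "(- A) *v x = - (A *v (x :: real ^ 'n))"
  by (simp add: matrix_vector_mult_def vec_eq_iff sum_negf)

text \<open>Substituting \<open>- (blk22 P ** Z0)\<close> for \<open>blk21 P\<close> turns the
  pseudoinverse term of the Schur complement into \<open>transpose Z0 ** blk22 P ** Z0\<close>,
  whichever solution \<open>Z0\<close> is taken.\<close>

lemma qform_complete_square:
  assumes P: "P \<in> symmetric_mats" and Z0: "blk22 P ** Z0 = - blk21 P"
  shows "qform P (join x y) = qform (gen_schur P) x + qform (blk22 P) (y - Z0 *v x)"
proof -
  let ?D = "blk22 P"
  note D = symmetric_blocks(2)[OF P]
  have tD: "transpose ?D = ?D" using D by (simp add: symmetric_mats_def)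
  have C: "blk21 P = - (?D ** Z0)" using Z0 by simp
  have B: "blk12 P = - (transpose Z0 ** ?D)"
    unfolding symmetric_blocks(3)[OF P] C
    by (simp add: matrix_transpose_mul tD transpose_uminus)
  have "?D ** pinv ?D ** ?D = ?D" using is_pinv_pinv[of ?D] by (simp add: is_pinv_def)
  then have "gen_schur P = blk11 P - transpose Z0 ** ?D ** Z0"
    unfolding gen_schur_def B C
    by (simp add: matrix_mul_uminus_left matrix_mul_uminus_right matrix_mul_assoc)
      (simp flip: matrix_mul_assoc)
  then have s: "qform (gen_schur P) x = x \<bullet> (blk11 P *v x) - qform ?D (Z0 *v x)"
    by (simp only: qform_def matrix_vector_mult_diff_rdistrib inner_diff_right
        transpose_inner flip: matrix_vector_mul_assoc)
  have Cx: "blk21 P *v x = - (?D *v (Z0 *v x))"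
    unfolding C by (simp add: matrix_vector_mul_assoc matrix_vector_mul_uminus_left)
  have By: "x \<bullet> (blk12 P *v y) = - ((Z0 *v x) \<bullet> (?D *v y))"
    unfolding symmetric_blocks(3)[OF P] transpose_inner Cx
    by (simp add: symmetric_mats_inner[OF D])
  have Cy: "y \<bullet> (?D *v (Z0 *v x)) = (Z0 *v x) \<bullet> (?D *v y)"
    using symmetric_mats_inner[OF D, of y "Z0 *v x"] by (simp add: inner_commute)
  show ?thesis
    unfolding s
    by (simp add: qform_def matrix_mult_join join_inner inner_add_right Cx By Cy
        matrix_vector_mult_diff_distrib inner_diff_left inner_diff_right)
qed

text \<open>The vector \<open>y - pinv ?D *v (?D *v y)\<close> lies in the kernel of
  \<open>?D\<close>, hence of \<open>blk12 P\<close>. So \<open>blk12 P\<close> factors through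
  \<open>?D\<close> on the right, and transposing gives the solution.\<close>

lemma schur_center_exists:
  assumes P: "P \<in> symmetric_mats" and ker: "mat_ker (blk22 P) \<subseteq> mat_ker (blk12 P)"
  shows "\<exists>Z0. blk22 P ** Z0 = - blk21 P"
proof -
  let ?D = "blk22 P"
  have tD: "transpose ?D = ?D" using symmetric_blocks(2)[OF P] by (simp add: symmetric_mats_def)
  have D: "?D ** pinv ?D ** ?D = ?D" using is_pinv_pinv[of ?D] by (simp add: is_pinv_def)
  have "blk12 P *v (y - pinv ?D *v (?D *v y)) = 0" for y
  proof -
    have "?D *v (y - pinv ?D *v (?D *v y)) = 0"
      using D by (simp add: matrix_vector_mult_diff_distrib matrix_vector_mul_assoc matrix_mul_assoc)
    then show ?thesis using ker by (auto simp: mat_ker_def)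
  qed
  then have "blk12 P *v y = (blk12 P ** pinv ?D ** ?D) *v y" for y
    by (simp add: matrix_vector_mult_diff_distrib matrix_vector_mul_assoc matrix_mul_assoc)
  then have "blk12 P = blk12 P ** pinv ?D ** ?D" by (simp add: matrix_eq)
  then have "transpose (blk12 P) = transpose (blk12 P ** pinv ?D ** ?D)" by simp
  then have "blk21 P = ?D ** (transpose (pinv ?D) ** blk21 P)"
    by (simp add: symmetric_blocks(3)[OF P] matrix_transpose_mul tD)
  then have "?D ** (- (transpose (pinv ?D) ** blk21 P)) = - blk21 P"
    by (simp add: matrix_mul_uminus_right)
  then show ?thesis by blast
qed

section \<open>Kronecker products and column stacking\<close>

lemma sum_UNIV_prod:
  "(\<Sum>k\<in>(UNIV :: ('a::finite \<times> 'b::finite) set). f k) = (\<Sum>b\<in>UNIV. \<Sum>a\<in>UNIV. f (a, b))"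
  by (subst sum.swap) (simp add: sum.cartesian_product case_prod_eta flip: UNIV_Times_UNIV)

text \<open>The familiar rule that \<open>C\<^sup>T\<close> \<otimes> \<open>B\<close> sends
  vec(\<open>X\<close>) to vec(\<open>B X C\<close>), with \<open>B\<close> the identity,
  \<open>X\<close> the transpose of \<open>W\<close> and \<open>C\<close> the transpose of
  \<open>A\<close>.\<close>

lemma kron_mult_vectorize:
  fixes W :: "real ^ 'p ^ 'q"
  shows "kron A (mat 1 :: real ^ 'p ^ 'p) ** vectorize (transpose W) = vectorize (transpose (A ** W))"
  by (simp add: vec_eq_iff kron_def vectorize_def matrix_matrix_mult_def transpose_def mat_def
      sum_UNIV_prod if_distrib if_distribR cong: if_cong)
   (simp add: sum.swap)

lemma vectorize_inner:
  fixes U W :: "real ^ 'p ^ 'q"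
  shows "(vectorize (transpose U) *v x) \<bullet> (vectorize (transpose W) *v x)
    = (x $ 1)\<^sup>2 * (\<Sum>i\<in>UNIV. column i U \<bullet> column i W)"
  by (simp add: inner_vec_def matrix_vector_mult_def vectorize_def transpose_def column_def
      sum_UNIV_prod sum_distrib_left power2_eq_square ac_simps)

lemma column_mult: "column i (A ** W) = A *v column i W"
  by (simp add: vec_eq_iff column_def matrix_matrix_mult_def matrix_vector_mult_def)

text \<open>The sum is the trace of \<open>transpose W ** A ** W\<close>, a weighted Frobenius form;
  \<open>x\<close> has a single entry because \<open>vectorize\<close> yields one column.\<close>

lemma qform_kron_vectorize:
  fixes W :: "real ^ 'p ^ 'q"
  shows "qform (kron A (mat 1 :: real ^ 'p ^ 'p)) (vectorize (transpose W) *v x)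
    = (x $ 1)\<^sup>2 * (\<Sum>i\<in>UNIV. qform A (column i W))"
  unfolding qform_def matrix_vector_mul_assoc kron_mult_vectorize vectorize_inner column_mult ..

section \<open>Rank one matrices and the comparison of the two norms\<close>

definition outer :: "real ^ 'q \<Rightarrow> real ^ 'p \<Rightarrow> real ^ 'p ^ 'q" where
  "outer y x = (\<chi> i j. y $ i * x $ j)"

lemma column_outer: "column i (outer y x) = x $ i *\<^sub>R y"
  by (simp add: column_def outer_def vec_eq_iff)

lemma outer_mult: "outer y x *v z = (x \<bullet> z) *\<^sub>R y"
  by (simp add: outer_def vec_eq_iff matrix_vector_mult_def inner_vec_def sum_distrib_right
      sum_distrib_left ac_simps)

lemma sum_qform_column_outer:
  "(\<Sum>i\<in>UNIV. qform A (column i (outer y x))) = (x \<bullet> x) * qform A y"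
  by (simp add: column_outer qform_scaleR inner_vec_def sum_distrib_right power2_eq_square)

text \<open>A Lagrange identity: the difference of the two sides is half of
  \<open>\<Sum>i j. qform A (x $ i *\<^sub>R W\<^sub>j - x $ j *\<^sub>R W\<^sub>i)\<close>, where \<open>W\<^sub>i\<close> is the \<open>i\<close>-th column of \<open>W\<close>.\<close>

lemma qform_mult_ge_sum_columns:
  fixes W :: "real ^ 'p ^ 'q"
  assumes A: "A \<in> symmetric_mats" and nsd: "\<And>y. qform A y \<le> 0"
  shows "(x \<bullet> x) * (\<Sum>i\<in>UNIV. qform A (column i W)) \<le> qform A (W *v x)"
proof -
  let ?c = "\<lambda>i. column i W"
  define T where "T = (\<Sum>i\<in>UNIV. qform A (?c i))"
  have Wx: "W *v x = (\<Sum>i\<in>UNIV. x $ i *\<^sub>R ?c i)"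
    by (simp add: matrix_mult_sum scalar_mult_eq_scaleR)
  have AWx: "A *v (W *v x) = (\<Sum>i\<in>UNIV. x $ i *\<^sub>R (A *v ?c i))"
    unfolding Wx by (simp add: matrix_vector_mult_scaleR linear_sum[OF matrix_vector_mul_linear])
  have full: "qform A (W *v x) = (\<Sum>i\<in>UNIV. \<Sum>j\<in>UNIV. x $ i * x $ j * (?c i \<bullet> (A *v ?c j)))"
    unfolding qform_def AWx
    by (subst sum.swap) (simp add: Wx inner_sum_left inner_sum_right sum_distrib_left ac_simps)
  have d: "qform A (x $ i *\<^sub>R ?c j - x $ j *\<^sub>R ?c i)
      = (x $ i)\<^sup>2 * qform A (?c j) + (x $ j)\<^sup>2 * qform A (?c i) - 2 * (x $ i * x $ j * (?c i \<bullet> (A *v ?c j)))" for i j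
    using qform_add[OF A, of "- (x $ j *\<^sub>R ?c i)" "x $ i *\<^sub>R ?c j"] qform_scaleR[of A "- (x $ j)" "?c i"]
    by (simp add: qform_scaleR matrix_vector_mult_scaleR)
  have "0 \<ge> (\<Sum>i\<in>UNIV. \<Sum>j\<in>UNIV. qform A (x $ i *\<^sub>R ?c j - x $ j *\<^sub>R ?c i))"
    by (intro sum_nonpos nsd)
  also have "(\<Sum>i\<in>UNIV. \<Sum>j\<in>UNIV. qform A (x $ i *\<^sub>R ?c j - x $ j *\<^sub>R ?c i))
     = (x \<bullet> x) * T + (x \<bullet> x) * T - 2 * qform A (W *v x)"
  proof -
    have 1: "(\<Sum>i\<in>UNIV. \<Sum>j\<in>UNIV. (x $ i)\<^sup>2 * qform A (?c j)) = (x \<bullet> x) * T"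
      by (simp add: T_def inner_vec_def sum_product power2_eq_square)
    have 2: "(\<Sum>i\<in>UNIV. \<Sum>j\<in>UNIV. (x $ j)\<^sup>2 * qform A (?c i)) = (x \<bullet> x) * T"
      by (subst sum.swap) (rule 1)
    show ?thesis
      unfolding d full by (simp only: sum.distrib sum_subtractf sum_distrib_left[of 2, symmetric] 1 2)
  qed
  finally show ?thesis by (simp add: T_def)
qed

section \<open>The matrix S-lemma\<close>

text \<open>A polynomial that is positive on the whole line cannot open downwards, and it cannot be
  linear with nonzero slope.\<close>

lemma quadratic_pos_nonpos_leading:
  fixes a b c :: real
  assumes pos: "\<And>t. 0 < a + 2 * t * b + t\<^sup>2 * c" and c: "c \<le> 0"
  shows "c = 0" "b = 0"
proof -
  have a: "0 < a" using pos[of 0] by simp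
  show c0: "c = 0"
  proof (rule ccontr)
    assume "c \<noteq> 0"
    then have n: "0 < - c" using c by simp
    \<comment> \<open>Here the constant and leading terms cancel, so the values at \<open>t\<close>
      and \<open>- t\<close> are opposite and cannot both be positive.\<close>
    define t where "t = sqrt (a / - c)"
    have "t\<^sup>2 = a / - c" unfolding t_def using a n by (intro real_sqrt_pow2 divide_nonneg_pos) simp_all
    then have "t\<^sup>2 * c = - a" using n by (simp add: field_simps)
    then show False using pos[of t] pos[of "- t"] a by simp
  qed
  show "b = 0"
  proof (rule ccontr)
    assume "b \<noteq> 0"
    then show False using pos[of "- a / (2 * b)"] a by (simp add: c0)
  qed
qed

lemma Pi_class_ker_mult_join:
  assumes "Q \<in> Pi_class" "blk22 Q *v k = 0"
  shows "Q *v join 0 k = 0"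
proof -
  have "blk12 Q *v k = 0" using assms by (auto simp: Pi_class_def mat_ker_def)
  then show ?thesis using assms(2) by (simp add: matrix_mult_join join_zero)
qed

text \<open>Adding a multiple of a kernel vector of \<open>blk22 Q\<close> to the lower half does not change the form
  of \<open>Q\<close>, so the form of \<open>M\<close> stays positive along that line; this is where the sign of
  \<open>blk22 M\<close> enters.\<close>

lemma ker_mult_join_of_implication:
  fixes M Q :: "real ^ ('p::finite + 'q::finite) ^ ('p + 'q)"
  assumes M: "M \<in> symmetric_mats" and Q: "Q \<in> Pi_class"
    and nsd: "loewner_le (blk22 M) 0"
    and imp: "\<And>x y. x \<noteq> 0 \<Longrightarrow> 0 \<le> qform Q (join x y) \<Longrightarrow> 0 < qform M (join x y)"
    and k: "blk22 Q *v k = 0"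
  shows "M *v join 0 k = 0"
proof -
  have Qs: "Q \<in> symmetric_mats" and schur: "\<And>x. 0 \<le> qform (gen_schur Q) x"
    using Q by (auto simp: Pi_class_def loewner_le_qform)
  have Ms: "blk22 M \<in> symmetric_mats" and Mn: "\<And>y. qform (blk22 M) y \<le> 0"
    using nsd symmetric_blocks(2)[OF M] by (auto simp: loewner_le_qform)
  obtain Z0 where Z0: "blk22 Q ** Z0 = - blk21 Q"
    using schur_center_exists Q by (auto simp: Pi_class_def)
  \<comment> \<open>At the center \<open>Z0 *v x\<close> the form of \<open>Q\<close> is that of the
    Schur complement, hence nonnegative, and it stays so along \<open>k\<close>. Thus the form of
    \<open>M\<close> is a positive polynomial in \<open>t\<close>.\<close>
  have line: "qform (blk22 M) k = 0 \<and> join x (Z0 *v x) \<bullet> (M *v join 0 k) = 0" if "x \<noteq> 0" for x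
  proof -
    let ?v = "join x (Z0 *v x)"
    have "0 < qform M ?v + 2 * t * (?v \<bullet> (M *v join 0 k)) + t\<^sup>2 * qform (blk22 M) k" for t
    proof -
      have j: "join x (Z0 *v x + t *\<^sub>R k) = ?v + t *\<^sub>R join 0 k"
        by (simp add: join_def vec_eq_iff split: sum.split)
      have "qform Q (join x (Z0 *v x + t *\<^sub>R k)) = qform (gen_schur Q) x"
        by (simp add: qform_complete_square[OF Qs Z0] qform_scaleR qform_def[of _ k] k)
      then have "0 < qform M (?v + t *\<^sub>R join 0 k)"
        using imp[OF that, of "Z0 *v x + t *\<^sub>R k"] schur j by simp
      moreover have "qform M (join 0 k) = qform (blk22 M) k"
        by (simp add: qform_def matrix_mult_join join_inner)
      ultimately show ?thesis
        by (simp add: qform_add[OF M] qform_scaleR matrix_vector_mult_scaleR)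
    qed
    from quadratic_pos_nonpos_leading[OF this Mn] show ?thesis by blast
  qed
  \<comment> \<open>Any nonzero vector serves to extract the part of \<open>line\<close> that is
    independent of \<open>x\<close>.\<close>
  have "axis undefined 1 \<noteq> (0 :: real ^ 'p)" by (simp add: axis_eq_0_iff)
  then have "qform (- blk22 M) k = 0"
    using line[of "axis undefined 1"] by (simp add: qform_def matrix_vector_mul_uminus_left)
  then have "(- blk22 M) *v k = 0"
    using Ms Mn symmetric_mats_diff[OF zero_symmetric_mats Ms]
    by (intro psd_qform_zero_imp_ker) (auto simp: qform_def matrix_vector_mul_uminus_left)
  then have M22: "blk22 M *v k = 0" by (simp add: matrix_vector_mul_uminus_left)
  have "x \<bullet> (blk12 M *v k) = 0" if "x \<noteq> 0" for x
    using line[OF that] by (simp add: matrix_mult_join join_inner M22)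
  then have "blk12 M *v k = 0" by (metis inner_eq_zero_iff)
  with M22 show ?thesis by (simp add: matrix_mult_join join_zero)
qed

text \<open>The S-lemma needs positivity of \<open>M\<close> at all nonzero vectors, whereas
  \<open>imp\<close> requires a nonzero upper half. Restricting the lower half to a complement of
  the kernel of \<open>blk22 Q\<close> closes this gap.\<close>

lemma matrix_S_lemma:
  fixes M Q :: "real ^ ('p::finite + 'q::finite) ^ ('p + 'q)"
  assumes M: "M \<in> symmetric_mats" and Q: "Q \<in> Pi_class"
    and neg: "loewner_le (blk22 M) 0 \<or> mat_ker (blk22 Q) = {0}"
    and imp: "\<And>x y. x \<noteq> 0 \<Longrightarrow> 0 \<le> qform Q (join x y) \<Longrightarrow> 0 < qform M (join x y)"
  shows "\<exists>\<alpha> \<beta>. \<alpha> \<ge> 0 \<and> \<beta> > 0 \<and> loewner_le (block_mat (\<beta> *\<^sub>R mat 1) 0 0 0) (M - \<alpha> *\<^sub>R Q)"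
proof -
  let ?D = "blk22 Q"
  let ?R = "pinv ?D"
  have Qs: "Q \<in> symmetric_mats" and Dn: "\<And>y. qform ?D y \<le> 0"
    using Q by (auto simp: Pi_class_def loewner_le_qform)
  have Ds: "- ?D \<in> symmetric_mats"
    using symmetric_mats_diff[OF zero_symmetric_mats symmetric_blocks(2)[OF Qs]] by simp
  have D: "?D ** ?R ** ?D = ?D" using is_pinv_pinv[of ?D] by (simp add: is_pinv_def)
  have kM: "M *v join 0 k = 0" if "?D *v k = 0" for k
    using neg
  proof
    assume "loewner_le (blk22 M) 0"
    then show ?thesis by (rule ker_mult_join_of_implication[OF M Q _ imp that])
  next
    assume "mat_ker ?D = {0}"
    then have "k = 0" using that by (auto simp: mat_ker_def)
    then show ?thesis by (simp add: join_zero)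
  qed
  \<comment> \<open>The product \<open>?R ** ?D\<close> is a projection with the same kernel as
    \<open>?D\<close>; \<open>V\<close> asks that the lower half lie in its range.\<close>
  define V where "V = {v :: real ^ ('p + 'q). ?R *v (?D *v lower v) = lower v}"
  have low: "lower (u + v) = lower u + lower v" "lower (c *\<^sub>R v) = c *\<^sub>R lower v" "lower 0 = 0"
    for u v :: "real ^ ('p + 'q)" and c
    by (simp_all add: lower_def vec_eq_iff)
  have V: "subspace V"
    by (auto simp: subspace_def V_def low matrix_vector_right_distrib matrix_vector_mult_scaleR)
  have pos: "0 < qform M v" if "v \<in> V" "v \<noteq> 0" "0 \<le> qform Q v" for v
  proof -
    have v: "v = join (upper v) (lower v)" by (simp add: join_upper_lower)
    have "upper v \<noteq> 0"
    proof
      assume u: "upper v = 0"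
      have "qform Q (join 0 (lower v)) = qform ?D (lower v)"
        by (simp add: qform_def matrix_mult_join join_inner)
      then have "qform ?D (lower v) = 0" using that(3) Dn[of "lower v"] v u by simp
      then have "(- ?D) *v lower v = 0"
        using Dn by (intro psd_qform_zero_imp_ker[OF Ds])
          (auto simp: qform_def matrix_vector_mul_uminus_left)
      then have "lower v = 0"
        using that(1) by (simp add: V_def matrix_vector_mul_uminus_left)
      then show False using that(2) v u by (metis join_zero)
    qed
    then show ?thesis using imp v that(3) by metis
  qed
  obtain \<alpha> \<beta> where ab: "0 \<le> \<alpha>" "0 < \<beta>"
    "\<And>v. v \<in> V \<Longrightarrow> \<beta> * (v \<bullet> v) \<le> qform M v - \<alpha> * qform Q v"
    using strict_S_lemma_subspace[OF M Qs V pos] by blast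
  have "qform (block_mat (\<beta> *\<^sub>R mat 1) 0 0 0) v \<le> qform (M - \<alpha> *\<^sub>R Q) v" for v :: "real ^ ('p + 'q)"
  proof -
    define x where "x = upper v"
    define y where "y = ?R *v (?D *v lower v)"
    define k where "k = lower v - y"
    have k: "?D *v k = 0"
      using D by (simp add: k_def y_def matrix_vector_mult_diff_distrib matrix_vector_mul_assoc matrix_mul_assoc)
    have v: "v = join x y + join 0 k"
      by (simp add: x_def k_def join_def upper_def lower_def vec_eq_iff split: sum.split)
    have "?D *v y = ?D *v lower v"
      using k by (simp add: k_def matrix_vector_mult_diff_distrib)
    then have "join x y \<in> V" by (simp add: V_def y_def)
    then have "\<beta> * (x \<bullet> x) + \<beta> * (y \<bullet> y) \<le> qform M (join x y) - \<alpha> * qform Q (join x y)"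
      using ab(3)[OF \<open>join x y \<in> V\<close>] by (simp add: join_inner distrib_left)
    \<comment> \<open>The margin in \<open>y\<close> is dropped, since the bound to be shown
      involves the upper half only.\<close>
    moreover have "0 \<le> \<beta> * (y \<bullet> y)" using ab(2) by simp
    moreover have "qform A v = qform A (join x y)" if "A \<in> symmetric_mats" "A *v join 0 k = 0" for A
      unfolding v qform_add[OF that(1)] by (simp add: that(2) qform_def[of A "join 0 k"])
    moreover have "qform (block_mat (\<beta> *\<^sub>R mat 1) 0 0 0) (join x (lower v)) = \<beta> * (x \<bullet> x)"
      by (simp add: qform_def matrix_mult_join join_inner flip: scaleR_matrix_vector_assoc)
    then have "qform (block_mat (\<beta> *\<^sub>R mat 1) 0 0 0) v = \<beta> * (x \<bullet> x)"
      by (simp add: x_def join_upper_lower)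
    ultimately show ?thesis
      using M Qs kM[OF k] Pi_class_ker_mult_join[OF Q k] by (simp add: qform_diff_scaleR)
  qed
  moreover have "block_mat (\<beta> *\<^sub>R mat 1) 0 0 0 \<in> (symmetric_mats :: (real ^ ('p + 'q) ^ ('p + 'q)) set)"
    by (intro symmetric_block_mat) (simp_all add: symmetric_mats_def transpose_def mat_def vec_eq_iff)
  ultimately have "loewner_le (block_mat (\<beta> *\<^sub>R mat 1) 0 0 0) (M - \<alpha> *\<^sub>R Q)"
    using M Qs by (simp add: loewner_le_qform symmetric_mats_diff symmetric_mats_scaleR)
  with ab show ?thesis by blast
qed

lemma matrix_S_lemma_converse:
  assumes "loewner_le (block_mat (\<beta> *\<^sub>R mat 1) 0 0 0) (M - \<alpha> *\<^sub>R Q)" "0 \<le> \<alpha>" "0 < \<beta>"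
    and x: "x \<noteq> 0" and Q: "0 \<le> qform Q (join x y)"
  shows "0 < qform M (join x y)"
proof -
  have "\<beta> * (x \<bullet> x) = qform (block_mat (\<beta> *\<^sub>R mat 1) 0 0 0) (join x y)"
    by (simp add: qform_def matrix_mult_join join_inner flip: scaleR_matrix_vector_assoc)
  also have "\<dots> \<le> qform M (join x y) - \<alpha> * qform Q (join x y)"
    using assms(1) by (simp add: loewner_le_qform qform_diff_scaleR)
  also have "\<dots> \<le> qform M (join x y)" using assms by simp
  finally show ?thesis using assms(3) x by (smt (verit) inner_gt_zero_iff mult_pos_pos)
qed

text \<open>Transposing the Penrose equations of a symmetric \<open>A\<close> shows that
  \<open>transpose (pinv A)\<close> satisfies them too, so uniqueness applies. This makes the upper
  left block of \<open>Q\<close> symmetric.\<close>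

lemma pinv_symmetric:
  assumes "A \<in> symmetric_mats"
  shows "pinv A \<in> symmetric_mats"
proof -
  have A: "transpose A = A" using assms by (simp add: symmetric_mats_def)
  let ?X = "pinv A"
  have X: "A ** ?X ** A = A" "?X ** A ** ?X = ?X" "transpose (A ** ?X) = A ** ?X"
    "transpose (?X ** A) = ?X ** A"
    using is_pinv_pinv[of A] by (auto simp: is_pinv_def)
  have "A ** transpose ?X ** A = A" "transpose ?X ** A ** transpose ?X = transpose ?X"
    using arg_cong[OF X(1), of transpose] arg_cong[OF X(2), of transpose]
    by (simp_all add: matrix_transpose_mul A matrix_mul_assoc)
  moreover have "A ** transpose ?X = ?X ** A" "transpose ?X ** A = A ** ?X"
    using X(3,4) by (simp_all add: matrix_transpose_mul A)
  ultimately have "is_pinv A (transpose ?X)"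
    using X(3,4) by (simp add: is_pinv_def)
  then have "transpose ?X = ?X" using is_pinv_unique is_pinv_pinv by blast
  then show ?thesis by (simp add: symmetric_mats_def)
qed

lemma qform_scaleR_mat_1: "qform (c *\<^sub>R mat 1) x = c * (x \<bullet> x)"
  by (simp add: qform_def flip: scaleR_matrix_vector_assoc)

theorem theorem1:
  fixes M Q :: "real ^ ('p::finite + 'q::finite) ^ ('p + 'q)"
    and N :: "real ^ (1 + 'q \<times> 'p) ^ (1 + 'q \<times> 'p)"
    and Q22 :: "real ^ 'q ^ 'q"
    and Q12 :: "real ^ 'q ^ 'p"
    and Q21 :: "real ^ 'p ^ 'q"
  assumes "M \<in> symmetric_mats"
    and "N \<in> Pi_class"
    and "Q22 \<in> symmetric_mats"
    and "blk22 N = kron Q22 (mat 1 :: real ^ 'p ^ 'p)"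
    and "vectorize Q12 = blk21 N"
    and "Q21 = transpose Q12"
    and "Q = block_mat ((gen_schur N $ 1 $ 1) *\<^sub>R mat 1 + Q12 ** pinv Q22 ** Q21) Q12 Q21 Q22"
  shows "((\<forall>Z :: real ^ 'p ^ 'q. vectorize (transpose Z) \<in> Zset N \<longrightarrow> Z \<in> Zset_pos M)
           \<longleftrightarrow> (\<forall>Z :: real ^ 'p ^ 'q. Z \<in> Zset Q \<longrightarrow> Z \<in> Zset_pos M))
       \<and> (loewner_le (blk22 M) 0 \<or> loewner_less (blk22 N) 0 \<longrightarrow>
           ((\<forall>Z :: real ^ 'p ^ 'q. vectorize (transpose Z) \<in> Zset N \<longrightarrow> Z \<in> Zset_pos M)
             \<longleftrightarrow> (\<exists>\<alpha> \<beta>. \<alpha> \<ge> 0 \<and> \<beta> > 0 \<and>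
                   loewner_le (block_mat (\<beta> *\<^sub>R mat 1) 0 0 0) (M - \<alpha> *\<^sub>R Q))))"
proof -
  note M = assms(1) and N22 = assms(4) and N21 = assms(5)
  define s where "s = gen_schur N $ 1 $ 1"
  let ?one = "1 :: real ^ 1"
  have Ns: "N \<in> symmetric_mats" using assms(2) by (simp add: Pi_class_def)
  have qs: "qform (gen_schur N) x = s * (x $ 1)\<^sup>2" for x :: "real ^ 1"
    by (simp add: qform_def s_def inner_vec_def matrix_vector_mult_def power2_eq_square)
  have s0: "0 \<le> s"
    using assms(2) qs[of ?one] by (auto simp: Pi_class_def loewner_le_qform dest: spec[of _ ?one])
  \<comment> \<open>A matrix with the single nonzero column \<open>y\<close> embeds the form of
    \<open>Q22\<close> in that of \<open>blk22 N\<close>, so signs carry over.\<close>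
  have kron_outer: "qform (blk22 N) (vectorize (transpose (outer y (axis i 1))) *v ?one) = qform Q22 y"
    for y :: "real ^ 'q" and i :: 'p
    by (simp add: N22 qform_kron_vectorize sum_qform_column_outer inner_axis_axis)
  have D: "qform Q22 y \<le> 0" for y
    using assms(2) kron_outer[of y] by (metis (mono_tags, lifting) Pi_class_def loewner_le_qform mem_Collect_eq qform_zero_mat)
  have ker: "mat_ker Q22 \<subseteq> mat_ker Q12"
  proof
    fix k assume "k \<in> mat_ker Q22"
    then have k: "Q22 *v k = 0" by (simp add: mat_ker_def)
    \<comment> \<open>Stacking the transpose of \<open>outer k a\<close> gives a kernel vector of
      \<open>blk22 N\<close>; its pairing with \<open>blk21 N\<close> is
      \<open>a \<bullet> a\<close>, which must therefore vanish.\<close>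
    define a where "a = Q12 *v k"
    let ?v = "vectorize (transpose (outer k a)) *v ?one"
    have "Q22 ** outer k a = 0"
      by (simp add: matrix_eq outer_mult matrix_vector_mult_scaleR k flip: matrix_vector_mul_assoc)
    then have "blk22 N *v ?v = 0"
      unfolding N22 matrix_vector_mul_assoc kron_mult_vectorize
      by (simp add: vectorize_def transpose_def matrix_vector_mult_def vec_eq_iff)
    then have "blk12 N *v ?v = 0" using assms(2) by (auto simp: Pi_class_def mat_ker_def)
    then have "0 = ?one \<bullet> (transpose (blk21 N) *v ?v)"
      using symmetric_blocks(3)[OF Ns] by simp
    also have "\<dots> = (vectorize (transpose (transpose Q12)) *v ?one) \<bullet> ?v"
      unfolding transpose_inner by (simp only: N21 transpose_transpose)
    also have "\<dots> = (\<Sum>i\<in>UNIV. a $ i * (row i Q12 \<bullet> k))"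
      unfolding vectorize_inner by (simp add: column_outer)
    also have "\<dots> = a \<bullet> a"
      by (simp add: a_def inner_vec_def[of "_ *v _"] matrix_vector_mul_component row_def)
    finally show "k \<in> mat_ker Q12" by (simp add: a_def mat_ker_def)
  qed
  have blkQ: "blk11 Q = s *\<^sub>R mat 1 + Q12 ** pinv Q22 ** Q21" "blk12 Q = Q12" "blk21 Q = Q21" "blk22 Q = Q22"
    by (simp_all add: assms(7) s_def)
  \<comment> \<open>The second summand of the upper left block is exactly what the Schur complement
    subtracts.\<close>
  have schurQ: "gen_schur Q = s *\<^sub>R mat 1" by (simp add: gen_schur_def blkQ)
  have I: "c *\<^sub>R mat 1 \<in> symmetric_mats" for c
    by (simp add: symmetric_mats_def transpose_scalar)
  have "Q12 ** pinv Q22 ** Q21 \<in> symmetric_mats"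
    using symmetric_congruence[OF pinv_symmetric[OF assms(3)], of Q21] by (simp add: assms(6))
  then have "s *\<^sub>R mat 1 + Q12 ** pinv Q22 ** Q21 \<in> symmetric_mats"
    using I[of s] by (simp add: symmetric_mats_def transpose_def vec_eq_iff)
  then have Qs: "Q \<in> symmetric_mats"
    unfolding assms(7) s_def using assms(3,6) by (rule symmetric_block_mat)
  have Q: "Q \<in> Pi_class"
    using symmetric_mats_diff[OF zero_symmetric_mats assms(3)] ker D s0 I
    by (simp add: Pi_class_def Qs blkQ schurQ loewner_le_qform qform_scaleR_mat_1)
  obtain Z0 where "blk22 Q ** Z0 = - blk21 Q"
    using schur_center_exists[OF Qs] ker blkQ by metis
  then have Z0: "Q22 ** Z0 = - Q21" by (simp add: blkQ)
  have qQ: "qform Q (join x y) = s * (x \<bullet> x) + qform Q22 (y - Z0 *v x)" for x y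
    using qform_complete_square[OF Qs, of Z0 x y] Z0 by (simp add: blkQ schurQ qform_scaleR_mat_1)
  \<comment> \<open>The same \<open>Z0\<close>, transposed and stacked, is a center for
    \<open>N\<close>, so both squares are completed around one point.\<close>
  have "blk22 N ** vectorize (transpose Z0) = - blk21 N"
    unfolding N22 kron_mult_vectorize Z0 N21[symmetric] assms(6)
    by (simp add: vectorize_def transpose_def vec_eq_iff)
  then have qN: "qform N (join x (vectorize (transpose Z) *v x))
      = (x $ 1)\<^sup>2 * (s + (\<Sum>i\<in>UNIV. qform Q22 (column i (Z - Z0))))" for x Z
  proof -
    have "vectorize (transpose Z) *v x - vectorize (transpose Z0) *v x = vectorize (transpose (Z - Z0)) *v x"
      by (simp add: vectorize_def transpose_def matrix_vector_mult_def vec_eq_iff left_diff_distrib)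
    then show ?thesis
      using qform_complete_square[OF Ns \<open>blk22 N ** vectorize (transpose Z0) = - blk21 N\<close>]
      by (simp add: qs N22 qform_kron_vectorize algebra_simps)
  qed
  have ZN: "vectorize (transpose Z) \<in> Zset N \<longleftrightarrow> 0 \<le> s + (\<Sum>i\<in>UNIV. qform Q22 (column i (Z - Z0)))" for Z
  proof
    assume "vectorize (transpose Z) \<in> Zset N"
    then have "0 \<le> qform N (join ?one (vectorize (transpose Z) *v ?one))"
      by (simp add: Zset_iff[OF Ns])
    then show "0 \<le> s + (\<Sum>i\<in>UNIV. qform Q22 (column i (Z - Z0)))"
      by (simp add: qN)
  qed (simp add: Zset_iff[OF Ns] qN)
  \<comment> \<open>The pointwise condition closes a cycle: \<open>IN\<close> gives
    \<open>H\<close>, \<open>H\<close> gives \<open>IQ\<close>, and \<open>IQ\<close> gives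
    \<open>IN\<close>.\<close>
  define H where "H \<longleftrightarrow> (\<forall>x y. x \<noteq> 0 \<longrightarrow> 0 \<le> qform Q (join x y) \<longrightarrow> 0 < qform M (join x y))"
  define IN where "IN \<longleftrightarrow> (\<forall>Z :: real ^ 'p ^ 'q. vectorize (transpose Z) \<in> Zset N \<longrightarrow> Z \<in> Zset_pos M)"
  define IQ where "IQ \<longleftrightarrow> (\<forall>Z :: real ^ 'p ^ 'q. Z \<in> Zset Q \<longrightarrow> Z \<in> Zset_pos M)"
  have "H" if "IN"
    unfolding H_def
  proof (intro allI impI)
    fix x :: "real ^ 'p" and y :: "real ^ 'q"
    assume x: "x \<noteq> 0" and q: "0 \<le> qform Q (join x y)"
    define w where "w = y - Z0 *v x"
    \<comment> \<open>The scaling makes the rank one correction send \<open>x\<close> to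
      \<open>w\<close>, so \<open>Z *v x = y\<close>, and its trace form is
      \<open>qform Q22 w / (x \<bullet> x)\<close>.\<close>
    define Z where "Z = Z0 + outer w ((1 / (x \<bullet> x)) *\<^sub>R x)"
    have xx: "0 < x \<bullet> x" using x by simp
    have "Z *v x = y"
      using xx by (simp add: Z_def matrix_vector_mult_add_rdistrib outer_mult w_def)
    moreover have "vectorize (transpose Z) \<in> Zset N"
    proof -
      have "0 \<le> (s * (x \<bullet> x) + qform Q22 w) / (x \<bullet> x)" using q xx by (simp add: qQ w_def)
      also have "\<dots> = s + (\<Sum>i\<in>UNIV. qform Q22 (column i (Z - Z0)))"
        using xx by (simp add: Z_def sum_qform_column_outer field_simps)
      finally show ?thesis by (simp add: ZN)
    qed
    ultimately show "0 < qform M (join x y)"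
      using that x by (auto simp: IN_def Zset_pos_iff[OF M])
  qed
  moreover have "IQ" if "H"
    using that by (auto simp: IQ_def H_def Zset_iff[OF Qs] Zset_pos_iff[OF M])
  moreover have "IN" if "IQ"
    unfolding IN_def
  proof (intro allI impI)
    fix Z :: "real ^ 'p ^ 'q"
    assume "vectorize (transpose Z) \<in> Zset N"
    then have T: "0 \<le> s + (\<Sum>i\<in>UNIV. qform Q22 (column i (Z - Z0)))" by (simp add: ZN)
    have "0 \<le> qform Q (join x (Z *v x))" for x
    proof -
      have "0 \<le> (x \<bullet> x) * (s + (\<Sum>i\<in>UNIV. qform Q22 (column i (Z - Z0))))"
        using T by simp
      \<comment> \<open>The Frobenius bound implies the spectral one.\<close>
      also have "\<dots> \<le> s * (x \<bullet> x) + qform Q22 ((Z - Z0) *v x)"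
        using qform_mult_ge_sum_columns[OF assms(3) D, of x "Z - Z0"] by (simp add: algebra_simps)
      finally show ?thesis by (simp add: qQ matrix_vector_mult_diff_rdistrib)
    qed
    then show "Z \<in> Zset_pos M" using that by (simp add: IQ_def Zset_iff[OF Qs])
  qed
  ultimately have equiv: "IN \<longleftrightarrow> IQ" "IN \<longleftrightarrow> H" by blast+
  have "IN \<longleftrightarrow> (\<exists>\<alpha> \<beta>. \<alpha> \<ge> 0 \<and> \<beta> > 0 \<and> loewner_le (block_mat (\<beta> *\<^sub>R mat 1) 0 0 0) (M - \<alpha> *\<^sub>R Q))"
    if neg: "loewner_le (blk22 M) 0 \<or> loewner_less (blk22 N) 0"
  proof -
    have "mat_ker Q22 = {0}" if less: "loewner_less (blk22 N) 0"
    proof -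
      have "y = 0" if y: "Q22 *v y = 0" for y
      proof (rule ccontr)
        assume "y \<noteq> 0"
        let ?v = "vectorize (transpose (outer y (axis undefined 1 :: real ^ 'p))) *v ?one"
        have z: "qform (blk22 N) ?v = 0" using kron_outer y by (simp add: qform_def[of Q22])
        \<comment> \<open>The embedding preserves norms, as the rank one formula with the identity
          as weight shows; hence \<open>?v\<close> is nonzero.\<close>
        have "?v \<bullet> ?v = y \<bullet> y"
          using sum_qform_column_outer[of "mat 1" y "axis undefined 1 :: real ^ 'p"]
          by (simp add: vectorize_inner qform_def inner_axis_axis)
        then have "?v \<noteq> 0" using \<open>y \<noteq> 0\<close> by force
        then show False using less z by (auto simp: loewner_less_qform)
      qed
      then show ?thesis by (auto simp: mat_ker_def)
    qed
    then have "loewner_le (blk22 M) 0 \<or> mat_ker (blk22 Q) = {0}" using neg by (auto simp: blkQ)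
    then show ?thesis
      using matrix_S_lemma[OF M Q] matrix_S_lemma_converse unfolding equiv(2) H_def by blast
  qed
  with equiv(1) show ?thesis by (simp add: IN_def IQ_def)
qed

end
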